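(* The following two statements are equivalent: (A) For every prime $p$, $p^2 \nmid u_{\gamma(p)}$. (B) For every integer $m \geq 2$: if $m^2 \mid u_{\gamma(m)}$, then $m \in \{6, 12\}$.
   Context: $(u_n)_{n\ge 0}$ is the Fibonacci sequence: $u_0=0$, $u_1=1$, $u_n=u_{n-1}+u_{n-2}$ for $n\ge 2$. For an integer $m\ge 1$, the period $\gamma(m)$ is the smallest positive integer $l$ with $u_l\equiv 0 \pmod m$ and $u_{l+1}\equiv 1 \pmod m$; equivalently, it is the order of the matrix $P=\begin{pmatrix}0&1\\1&1\end{pmatrix}$ in $\mathrm{GL}_2(\mathbb{Z}/m\mathbb{Z})$. *)

theory Defs
  imports "HOL-Number_Theory.Number_Theory"
begin

definition fib_period :: "nat \<Rightarrow> nat" where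
  "fib_period m = (LEAST l. l > 0 \<and> [fib l = 0] (mod m) \<and> [fib (l + 1) = 1] (mod m))"

text \<open>For \<open>m \<ge> 1\<close> the set over which the minimum is taken is nonempty.\<close>

lemma fib_period_exists:
  assumes "m \<ge> 1"
  shows "\<exists>l>0. [fib l = 0] (mod m) \<and> [fib (l + 1) = 1] (mod m)"
proof -
  let ?f = "\<lambda>n. (fib n mod m, fib (n + 1) mod m)"
  have "range ?f \<subseteq> {..<m} \<times> {..<m}"
    using assms by auto
  then have "finite (range ?f)"
    by (rule finite_subset) auto
  then have "\<not> inj ?f"
    using finite_imageD infinite_UNIV_nat by blast
  then obtain a b where ab: "a < b" "?f a = ?f b"
    unfolding inj_def by (metis linorder_neqE_nat)
  define d where "d = b - a"
  have d: "d > 0" "b = a + d"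
    using ab by (auto simp: d_def)
  have shift: "[fib d = 0] (mod m) \<and> [fib (d + 1) = 1] (mod m)"
    if "[fib (i + d) = fib i] (mod m)" "[fib (i + d + 1) = fib (i + 1)] (mod m)" for i
    using that
  proof (induction i)
    case 0
    then show ?case by simp
  next
    case (Suc i)
    have 1: "[fib (Suc (i + d)) = fib (Suc i)] (mod m)"
      using Suc.prems(1) by simp
    have "[fib (Suc (i + d)) + fib (i + d) = fib (Suc i) + fib i] (mod m)"
      using Suc.prems(2) by simp
    moreover have "[fib (Suc (i + d)) + fib i = fib (Suc i) + fib i] (mod m)"
      using 1 by (simp add: cong_add_rcancel_nat)
    ultimately have "[fib (Suc (i + d)) + fib (i + d) = fib (Suc (i + d)) + fib i] (mod m)"
      using cong_sym cong_trans by blast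
    then have "[fib (i + d) = fib i] (mod m)"
      by (simp add: cong_add_lcancel_nat)
    then show ?case
      using Suc.IH 1 by simp
  qed
  have "[fib (a + d) = fib a] (mod m)" "[fib (a + d + 1) = fib (a + 1)] (mod m)"
    using ab d by (auto simp: cong_def)
  then show ?thesis
    using shift d by blast
qed

end

theory Submission
  imports Defs
begin

text \<open>
  Suppose that (A) holds and \<open>m\<^sup>2\<close> divides \<open>u\<^bsub>\<gamma>(m)\<^esub>\<close>. Let \<open>p\<close> be the largest prime factor
  of \<open>m\<close> and \<open>e \<ge> 1\<close> its exponent. If \<open>p \<ge> 5\<close>, then \<open>p\<close> divides no period of a smaller prime \<open>q\<close>,
  because \<open>\<gamma>(q)\<close> divides \<open>q - 1\<close> or \<open>2 (q + 1)\<close> for \<open>q \<noteq> 2, 5\<close>. Hence \<open>\<gamma>(m)\<close> divides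
  \<open>\<gamma>(p) p^(e - 1) r\<close> with \<open>r\<close> prime to \<open>p\<close>. Lifting the exponent together with (A) shows that
  \<open>p\<close> has exponent exactly \<open>e\<close> in the Fibonacci number with that index, whereas \<open>2 e\<close> is needed.
  So \<open>m = 3^e 2^f\<close>. The same argument excludes \<open>e \<ge> 2\<close>, and for \<open>e \<le> 1\<close> the exponent
  \<open>j + 3\<close> of \<open>2\<close> in \<open>u\<^bsub>6 \<cdot> 2^j\<^esub>\<close> leaves only \<open>m = 6\<close> and \<open>m = 12\<close>.
\<close>

section \<open>Indices at which the sequence returns to its start\<close>

definition is_period :: "nat \<Rightarrow> nat \<Rightarrow> bool" where
  "is_period m n \<longleftrightarrow> [fib n = 0] (mod m) \<and> [fib (n + 1) = 1] (mod m)"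

lemma is_period_0: "is_period m 0"
  by (simp add: is_period_def)

lemma is_period_shift:
  assumes "is_period m a"
  shows "[fib (b + a) = fib b] (mod m)"
proof (induction b rule: fib.induct)
  case 1
  then show ?case using assms by (simp add: is_period_def)
next
  case 2
  then show ?case using assms by (simp add: is_period_def)
next
  case (3 n)
  then show ?case by (simp add: cong_add)
qed

lemma is_period_add_iff:
  assumes "is_period m a"
  shows "is_period m (b + a) \<longleftrightarrow> is_period m b"
proof -
  have "[fib (b + a) = fib b] (mod m)" "[fib (b + 1 + a) = fib (b + 1)] (mod m)"
    using is_period_shift[OF assms] by blast+
  then show ?thesis
    unfolding is_period_def by (auto simp: cong_def)
qed

lemma is_period_mult:
  assumes "is_period m a"
  shows "is_period m (a * k)"
proof (induction k)
  case 0
  show ?case by (simp add: is_period_0)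
next
  case (Suc k)
  then show ?case
    using is_period_add_iff[OF assms, of "a * k"] by (simp add: add.commute)
qed

lemma is_period_dvd:
  assumes "is_period m a" "a dvd b"
  shows "is_period m b"
  using assms is_period_mult by blast

lemma is_period_fib_period:
  assumes "m \<ge> 1"
  shows "fib_period m > 0" "is_period m (fib_period m)"
  using LeastI_ex[OF fib_period_exists[OF assms]]
  by (simp_all add: fib_period_def is_period_def)

text \<open>The remainder of \<open>n\<close> modulo the least positive index again satisfies
  \<open>is_period m\<close>, so minimality forces it to be 0.\<close>

lemma fib_period_dvd:
  assumes "m \<ge> 1" "is_period m n"
  shows "fib_period m dvd n"
proof -
  let ?l = "fib_period m"
  have "is_period m (n mod ?l + ?l * (n div ?l))"
    using assms by simp
  then have "is_period m (n mod ?l)"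
    using is_period_add_iff is_period_mult is_period_fib_period(2)[OF assms(1)] by blast
  moreover have "n mod ?l < ?l"
    using is_period_fib_period(1)[OF assms(1)] by simp
  ultimately have "\<not> n mod ?l > 0"
    using not_less_Least[of "n mod ?l" "\<lambda>l. l > 0 \<and> [fib l = 0] (mod m) \<and> [fib (l + 1) = 1] (mod m)"]
    by (auto simp: fib_period_def is_period_def)
  then show ?thesis by auto
qed

lemma fib_dvd_fib:
  assumes "a dvd b"
  shows "fib a dvd fib b"
  by (metis assms fib_gcd gcd_dvd2 gcd_nat.absorb1)

text \<open>To refute \<open>m^2 dvd fib (fib_period m)\<close> it thus suffices to refute
  \<open>m^2 dvd fib n\<close> for one convenient \<open>n\<close>, without knowing the exact
  period.\<close>

lemma fib_fib_period_dvd: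
  assumes "m \<ge> 1" "is_period m n"
  shows "fib (fib_period m) dvd fib n"
  using fib_dvd_fib fib_period_dvd[OF assms] by blast

lemma is_period_coprime_mult:
  assumes "coprime a b" "is_period a n" "is_period b n"
  shows "is_period (a * b) n"
  using assms unfolding is_period_def by (simp add: coprime_cong_mult_nat)

text \<open>The product is cruder than the least common multiple, but it stays prime to a given
  prime when both factors are.\<close>

lemma is_period_coprime_mult':
  assumes "coprime a b" "is_period a k" "is_period b l"
  shows "is_period (a * b) (k * l)"
  using assms by (meson dvd_triv_left dvd_triv_right is_period_coprime_mult is_period_dvd)

section \<open>Powers of the Fibonacci matrix and lifting of periods\<close>

lemma is_period_iff_int:
  "is_period m n \<longleftrightarrow> int m dvd int (fib n) \<and> int m dvd int (fib (n + 1)) - 1"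
proof -
  have "[fib (n + 1) = 1] (mod m) \<longleftrightarrow> [int (fib (n + 1)) = int 1] (mod int m)"
    by (simp only: cong_int_iff)
  then show ?thesis
    unfolding is_period_def by (simp add: cong_0_iff cong_iff_dvd_diff)
qed

text \<open>This is the binomial expansion of \<open>(c I + d P)^k = P^((i + 1) k)\<close>, where \<open>P\<close> is the
  Fibonacci matrix. The factor \<open>c\<^sup>2\<close> avoids negative exponents.\<close>

lemma fib_mult_expansion:
  fixes i k :: nat
  defines "d \<equiv> int (fib (Suc i))" and "c \<equiv> int (fib i)"
  shows "d ^ 3 dvd c\<^sup>2 * int (fib (Suc i * k))
             - (int k * d * c ^ (k + 1) + int (k choose 2) * d\<^sup>2 * c ^ k)"
    and "d\<^sup>2 dvd c\<^sup>2 * int (fib (Suc i * k + 1)) - (c ^ (k + 2) + int k * d * c ^ (k + 1))"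
proof -
  have "d ^ 3 dvd c\<^sup>2 * int (fib (Suc i * k))
             - (int k * d * c ^ (k + 1) + int (k choose 2) * d\<^sup>2 * c ^ k) \<and>
        d\<^sup>2 dvd c\<^sup>2 * int (fib (Suc i * k + 1)) - (c ^ (k + 2) + int k * d * c ^ (k + 1))"
  proof (induction k)
    case 0
    then show ?case by (simp add: power2_eq_square binomial_eq_0)
  next
    case (Suc k)
    define F G where "F = int (fib (Suc i * k))" and "G = int (fib (Suc i * k + 1))"
    obtain x y where
      x: "c\<^sup>2 * F = int k * d * c ^ (k + 1) + int (k choose 2) * d\<^sup>2 * c ^ k + d ^ 3 * x" and
      y: "c\<^sup>2 * G = c ^ (k + 2) + int k * d * c ^ (k + 1) + d\<^sup>2 * y"
      using Suc.IH unfolding F_def G_def dvd_def by (metis diff_eq_eq add.commute)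
    \<comment> \<open>Multiplication by \<open>c I + d P\<close> sends the vector
      \<open>(F, G)\<close> to \<open>(c F + d G, d F + (c + d) G)\<close>.\<close>
    have F': "int (fib (Suc i * Suc k)) = d * G + c * F"
      using fib_add[of i "Suc i * k"]
      by (simp add: F_def G_def c_def d_def algebra_simps)
    have G': "int (fib (Suc i * Suc k + 1)) = (c + d) * G + d * F"
      using fib_add[of "Suc i" "Suc i * k"]
      by (simp add: F_def G_def c_def d_def algebra_simps)
    have ch: "int (Suc k choose 2) = int (k choose 2) + int k"
      by (simp add: numeral_2_eq_2)
    have "c\<^sup>2 * int (fib (Suc i * Suc k)) = d * (c\<^sup>2 * G) + c * (c\<^sup>2 * F)"
      unfolding F' by (simp add: algebra_simps)
    \<comment> \<open>The error of \<open>G\<close> enters multiplied by \<open>d\<close>, so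
      precision \<open>d^2\<close> for \<open>G\<close> suffices for precision \<open>d^3\<close>
      for \<open>F\<close>.\<close>
    also have "\<dots> = int (Suc k) * d * c ^ (Suc k + 1) + int (Suc k choose 2) * d\<^sup>2 * c ^ Suc k
        + d ^ 3 * (y + c * x)"
      unfolding x y ch by (simp add: algebra_simps power2_eq_square power3_eq_cube)
    finally have 1: "d ^ 3 dvd c\<^sup>2 * int (fib (Suc i * Suc k))
        - (int (Suc k) * d * c ^ (Suc k + 1) + int (Suc k choose 2) * d\<^sup>2 * c ^ Suc k)"
      by simp
    have "c\<^sup>2 * int (fib (Suc i * Suc k + 1)) = (c + d) * (c\<^sup>2 * G) + d * (c\<^sup>2 * F)"
      unfolding G' by (simp add: algebra_simps)
    also have "\<dots> = c ^ (Suc k + 2) + int (Suc k) * d * c ^ (Suc k + 1)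
       + d\<^sup>2 * ((c + d) * y + int k * c ^ (k + 1) + int k * c ^ (k + 1)
               + int (k choose 2) * d * c ^ k + d\<^sup>2 * x)"
      unfolding x y by (simp add: algebra_simps power2_eq_square power3_eq_cube)
    finally have 2: "d\<^sup>2 dvd c\<^sup>2 * int (fib (Suc i * Suc k + 1))
        - (c ^ (Suc k + 2) + int (Suc k) * d * c ^ (Suc k + 1))"
      by simp
    show ?case using 1 2 by blast
  qed
  then show "d ^ 3 dvd c\<^sup>2 * int (fib (Suc i * k))
             - (int k * d * c ^ (k + 1) + int (k choose 2) * d\<^sup>2 * c ^ k)"
    and "d\<^sup>2 dvd c\<^sup>2 * int (fib (Suc i * k + 1)) - (c ^ (k + 2) + int k * d * c ^ (k + 1))"
    by blast+
qed

text \<open>Write \<open>P^n = c I + d P\<close> with \<open>d = 0\<close> and \<open>c = 1\<close>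
  modulo \<open>m\<close>. In the \<open>q\<close>-th power the linear term has the factor
  \<open>q d\<close>, and all later terms have the factor \<open>d^2\<close>, so modulo
  \<open>q m\<close> only \<open>c^q I\<close> remains.\<close>

lemma is_period_lift:
  assumes "q dvd m" "is_period m n"
  shows "is_period (q * m) (n * q)"
proof (cases n)
  case 0
  then show ?thesis by (simp add: is_period_0)
next
  case (Suc i)
  define d c where "d = int (fib (Suc i))" and "c = int (fib i)"
  define Q M where "Q = int q" and "M = int m"
  have QM: "Q dvd M" using assms(1) by (simp add: Q_def M_def)
  have dM: "M dvd d" and "M dvd c + d - 1"
    using assms(2) by (simp_all add: is_period_iff_int Suc d_def c_def M_def algebra_simps)
  then have cM: "M dvd c - 1"
    using dvd_diff[of M "c + d - 1" d] by (simp add: algebra_simps)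
  have "coprime c M"
    unfolding coprime_def
    using cM by (metis dvd_trans dvd_diff diff_diff_eq2 add_diff_cancel_left')
  \<comment> \<open>This permits cancelling the auxiliary factor \<open>c^2\<close> of the
    expansion.\<close>
  then have cop: "coprime (Q * M) (c\<^sup>2)"
    using QM by (metis coprime_commute coprime_divisors coprime_mult_left_iff coprime_power_right_iff dvd_refl)
  have QMd: "Q * M dvd Q * d" and QMd2: "Q * M dvd d\<^sup>2"
    using QM dM by (auto simp: power2_eq_square intro: mult_dvd_mono dvd_trans)
  note e = fib_mult_expansion[of i q, folded d_def c_def Q_def]
  have "Q * M dvd d ^ 3"
    using QMd2 by (simp add: power3_eq_cube power2_eq_square)
  then have "Q * M dvd c\<^sup>2 * int (fib (Suc i * q))
             - (Q * d * c ^ (q + 1) + int (q choose 2) * d\<^sup>2 * c ^ q)"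
    using e(1) dvd_trans by blast
  moreover have "Q * M dvd Q * d * c ^ (q + 1) + int (q choose 2) * d\<^sup>2 * c ^ q"
    using QMd QMd2 by (intro dvd_add) (auto intro: dvd_mult dvd_mult2)
  ultimately have "Q * M dvd c\<^sup>2 * int (fib (Suc i * q))"
    by (metis diff_add_cancel dvd_add)
  then have 1: "Q * M dvd int (fib (Suc i * q))"
    using cop coprime_dvd_mult_right_iff by blast
  have "Q * M dvd c\<^sup>2 * int (fib (Suc i * q + 1)) - (c ^ (q + 2) + Q * d * c ^ (q + 1))"
    using e(2) QMd2 dvd_trans by blast
  moreover have "Q * M dvd Q * d * c ^ (q + 1)"
    using QMd dvd_mult2 by blast
  ultimately have "Q * M dvd c\<^sup>2 * int (fib (Suc i * q + 1)) - (c ^ (q + 2) + Q * d * c ^ (q + 1))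
       + Q * d * c ^ (q + 1)"
    by (rule dvd_add)
  then have "Q * M dvd c\<^sup>2 * (int (fib (Suc i * q + 1)) - c ^ q)"
    by (simp add: algebra_simps power_add power2_eq_square)
  then have 2: "Q * M dvd int (fib (Suc i * q + 1)) - c ^ q"
    using cop coprime_dvd_mult_right_iff by blast
  \<comment> \<open>In \<open>c^q - 1 = (c - 1) (1 + c + ... + c^(q - 1))\<close> the first factor
    supplies \<open>M\<close>; the second is a sum of \<open>q\<close> terms congruent to 1 and
    supplies \<open>Q\<close>.\<close>
  have "[(\<Sum>j<q. c ^ j) = (\<Sum>j<q. 1 ^ j)] (mod Q)"
    using cM QM by (intro cong_sum cong_pow) (auto simp: cong_iff_dvd_diff intro: dvd_trans)
  then have "Q dvd (\<Sum>j<q. c ^ j)"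
    by (simp add: cong_dvd_iff Q_def)
  then have 3: "Q * M dvd c ^ q - 1"
    using cM by (simp add: power_diff_1_eq mult.commute[of Q] mult_dvd_mono)
  have "Q * M dvd int (fib (Suc i * q + 1)) - 1"
    using dvd_add[OF 2 3] by simp
  then show ?thesis
    using 1 by (simp add: is_period_iff_int Suc Q_def M_def)
qed

section \<open>Exact exponents of primes in Fibonacci numbers\<close>

lemma prime_not_dvd_fib_pred:
  assumes "prime p" "p dvd fib (Suc i)"
  shows "\<not> p dvd fib i"
  using assms coprime_fib_Suc_nat[of i] by (meson coprime_common_divisor not_prime_unit)

text \<open>By the expansion, the quotient \<open>f\<close> of \<open>fib (n * k)\<close> by
  \<open>fib n\<close> satisfies \<open>c^2 f = k c^(k + 1)\<close> modulo \<open>d\<close>, hence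
  modulo \<open>p\<close>, and \<open>p\<close> divides neither \<open>k\<close> nor
  \<open>c\<close>.\<close>

lemma fib_mult_coprime_val:
  assumes p: "prime p" and fn: "fib n = p ^ s * w" "s > 0" "\<not> p dvd w" and k: "\<not> p dvd k"
  shows "\<exists>w'. fib (n * k) = p ^ s * w' \<and> \<not> p dvd w'"
proof (cases n)
  case 0
  then show ?thesis using fn p by (auto simp: prime_gt_0_nat)
next
  case (Suc i)
  define d c where "d = int (fib (Suc i))" and "c = int (fib i)"
  have pd: "p dvd fib (Suc i)" using fn Suc by simp
  then have pc: "\<not> int p dvd c"
    using prime_not_dvd_fib_pred[OF p] by (simp add: c_def)
  have pp: "prime (int p)" using p by simp
  have d0: "d \<noteq> 0" by (simp add: d_def fib_neq_0_nat less_imp_neq[symmetric] del: fib.simps)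
  have "fib (Suc i) dvd fib (Suc i * k)" by (rule fib_dvd_fib[OF dvd_triv_left])
  then obtain f where f: "fib (Suc i * k) = fib (Suc i) * f" by blast
  obtain x where "c\<^sup>2 * int (fib (Suc i * k))
      = int k * d * c ^ (k + 1) + int (k choose 2) * d\<^sup>2 * c ^ k + d ^ 3 * x"
    using fib_mult_expansion(1)[of i k, folded d_def c_def] unfolding dvd_def
    by (metis diff_eq_eq add.commute)
  then have "d * (c\<^sup>2 * int f) = d * (int k * c ^ (k + 1) + d * (int (k choose 2) * c ^ k + d * x))"
    unfolding f by (simp add: d_def[symmetric] algebra_simps power2_eq_square power3_eq_cube del: fib.simps)
  then have e: "c\<^sup>2 * int f = int k * c ^ (k + 1) + d * (int (k choose 2) * c ^ k + d * x)"
    using d0 by simp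
  have "\<not> int p dvd int f"
  proof
    assume "int p dvd int f"
    then have "int p dvd c\<^sup>2 * int f" by simp
    moreover have "int p dvd d * (int (k choose 2) * c ^ k + d * x)"
      using pd by (simp add: d_def del: fib.simps)
    ultimately have "int p dvd int k * c ^ (k + 1)"
      unfolding e by (simp add: dvd_add_left_iff)
    then show False
      using pp pc k by (metis int_dvd_int_iff prime_dvd_mult_iff prime_dvd_power)
  qed
  then have "\<not> p dvd w * f" using p fn(3) by (simp add: prime_dvd_mult_iff)
  moreover have "fib (n * k) = p ^ s * (w * f)"
    using f fn(1) Suc by simp
  ultimately show ?thesis by blast
qed

text \<open>Here the quotient satisfies \<open>c^2 f = p c^(p + 1)\<close> modulo
  \<open>p^2\<close>, and \<open>p\<close> does not divide \<open>c\<close>, so \<open>f\<close>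
  carries exactly one factor \<open>p\<close>.\<close>

lemma fib_mult_prime_val:
  assumes p: "prime p" "odd p" and fn: "fib n = p ^ s * w" "s > 0" "\<not> p dvd w"
  shows "\<exists>w'. fib (n * p) = p ^ Suc s * w' \<and> \<not> p dvd w'"
proof (cases n)
  case 0
  then show ?thesis using fn p by (auto simp: prime_gt_0_nat)
next
  case (Suc i)
  define d c P where "d = int (fib (Suc i))" and "c = int (fib i)" and "P = int p"
  have pd: "p dvd fib (Suc i)" using fn Suc by simp
  then have pc: "\<not> P dvd c"
    using prime_not_dvd_fib_pred[OF p(1)] by (simp add: c_def P_def)
  have pp: "prime P" using p by (simp add: P_def)
  have p2: "p > 2" using p prime_ge_2_nat[OF p(1)] by (cases "p = 2") auto
  have d0: "d \<noteq> 0" by (simp add: d_def fib_neq_0_nat less_imp_neq[symmetric] del: fib.simps)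
  have "fib (Suc i) dvd fib (Suc i * p)" by (rule fib_dvd_fib[OF dvd_triv_left])
  then obtain f where f: "fib (Suc i * p) = fib (Suc i) * f" by blast
  obtain x where "c\<^sup>2 * int (fib (Suc i * p))
      = P * d * c ^ (p + 1) + int (p choose 2) * d\<^sup>2 * c ^ p + d ^ 3 * x"
    using fib_mult_expansion(1)[of i p, folded d_def c_def P_def] unfolding dvd_def
    by (metis diff_eq_eq add.commute)
  then have "d * (c\<^sup>2 * int f) = d * (P * c ^ (p + 1) + int (p choose 2) * d * c ^ p + d * d * x)"
    unfolding f by (simp add: d_def[symmetric] algebra_simps power2_eq_square power3_eq_cube del: fib.simps)
  then have e: "c\<^sup>2 * int f = P * c ^ (p + 1) + int (p choose 2) * d * c ^ p + d * d * x"
    using d0 by simp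
  \<comment> \<open>Together with \<open>p\<close> dividing \<open>d\<close>, this makes the
    quadratic term a multiple of \<open>p^2\<close>. For \<open>p = 2\<close> the binomial would be
    1.\<close>
  have "p dvd (p choose 2)"
    using p2 p by (intro dvd_choose_prime) auto
  then obtain b where b: "int (p choose 2) = P * b"
    unfolding P_def by (metis dvdE of_nat_mult)
  obtain g where g: "d = P * g"
    using pd unfolding P_def d_def by (metis dvdE of_nat_mult)
  have e2: "c\<^sup>2 * int f = P * (c ^ (p + 1) + P * (b * g * c ^ p + g * g * x))"
    unfolding e b g by (simp add: algebra_simps)
  then have "P dvd c\<^sup>2 * int f" by simp
  then have "P dvd int f"
    using pp pc by (meson prime_dvd_mult_iff prime_dvd_power)
  then obtain h where h: "f = p * h" unfolding P_def by auto
  have "P * (c\<^sup>2 * int h) = P * (c ^ (p + 1) + P * (b * g * c ^ p + g * g * x))"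
    using e2 h by (simp add: P_def algebra_simps)
  then have e3: "c\<^sup>2 * int h = c ^ (p + 1) + P * (b * g * c ^ p + g * g * x)"
    using pp by simp
  have "\<not> P dvd int h"
  proof
    assume "P dvd int h"
    then have "P dvd c\<^sup>2 * int h" by simp
    then have "P dvd c ^ (p + 1)"
      unfolding e3 by (simp add: dvd_add_left_iff)
    then show False
      using pp pc by (meson prime_dvd_power)
  qed
  then have "\<not> p dvd w * h" using p fn(3) by (simp add: prime_dvd_mult_iff P_def)
  moreover have "fib (n * p) = p ^ Suc s * (w * h)"
    using f h fn(1) Suc by (simp add: algebra_simps)
  ultimately show ?thesis by blast
qed

text \<open>The exponent of \<open>p\<close> is 1 at index \<open>n\<close>, each factor
  \<open>p\<close> of the index adds one, and \<open>r\<close> adds none; the total is exactly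
  \<open>j + 1\<close>.\<close>

lemma fib_val:
  assumes p: "prime p" "odd p" and fn: "p dvd fib n" "\<not> p\<^sup>2 dvd fib n" and r: "\<not> p dvd r"
  shows "\<not> p ^ (j + 2) dvd fib (n * p ^ j * r)"
proof -
  have "\<exists>w. fib (n * p ^ j) = p ^ Suc j * w \<and> \<not> p dvd w"
  proof (induction j)
    case 0
    then show ?case using fn by (auto elim!: dvdE simp: power2_eq_square)
  next
    case (Suc j)
    then show ?case
      using fib_mult_prime_val[OF p, of "n * p ^ j" "Suc j"] by (auto simp: mult_ac)
  qed
  then obtain w where "fib (n * p ^ j * r) = p ^ Suc j * w" "\<not> p dvd w"
    using fib_mult_coprime_val[OF p(1) _ _ _ r] by blast
  moreover have "p ^ (j + 2) = p ^ Suc j * p" by simp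
  ultimately show ?thesis
    using p(1) by auto
qed

text \<open>This is \<open>u_{2n} = u_n (2 u_{n+1} - u_n)\<close>, rearranged to avoid subtraction
  of natural numbers.\<close>

lemma fib_double: "fib (2 * n) + fib n * fib n = 2 * fib n * fib (n + 1)"
proof (cases n)
  case (Suc i)
  then show ?thesis
    using fib_add[of i n] by (simp add: algebra_simps mult_2_right)
qed simp

text \<open>Start from \<open>u_6 = 8\<close>. When the index \<open>n\<close> doubles, the new
  factor \<open>2 u_{n+1} - u_n\<close> is twice an odd number, because \<open>u_{n+1}\<close> is
  odd and 4 divides \<open>u_n\<close>.\<close>

lemma fib_6_times_power_2: "\<exists>w. odd w \<and> fib (6 * 2 ^ j) = 2 ^ (j + 3) * w"
proof (induction j)
  case 0
  then show ?case by (intro exI[of _ 1]) (simp add: eval_nat_numeral)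
next
  case (Suc j)
  define n :: nat where "n = 6 * 2 ^ j"
  obtain w where w: "odd w" "fib n = 2 ^ (j + 3) * w"
    using Suc unfolding n_def by blast
  have "odd (fib (n + 1))"
    using prime_not_dvd_fib_pred[of 2 n] coprime_fib_Suc_nat[of n] w(2)
    by (auto simp: power_add dest: coprime_common_divisor[of _ _ 2])
  then obtain v where v: "fib (n + 1) = 2 * v + 1" by (auto elim: oddE)
  have "int (fib (2 * n)) = int (fib n) * (2 * int (fib (n + 1)) - int (fib n))"
    using arg_cong[OF fib_double[of n], of int] by (simp add: algebra_simps)
  also have "\<dots> = 2 ^ (j + 4) * (int w * (2 * int v + 1 - 4 * 2 ^ j * int w))"
    unfolding v w(2) by (simp add: algebra_simps power_add)
  finally have e: "int (fib (2 * n)) = 2 ^ (j + 4) * (int w * (2 * int v + 1 - 4 * 2 ^ j * int w))" .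
  then have "int (2 ^ (j + 4)) dvd int (fib (2 * n))" by simp
  then obtain u where u: "fib (2 * n) = 2 ^ (j + 4) * u"
    by (auto simp only: int_dvd_int_iff)
  then have "int u = int w * (2 * int v + 1 - 4 * 2 ^ j * int w)" using e by simp
  moreover have "odd (int w * (2 * int v + 1 - 4 * 2 ^ j * int w))" using w(1) by simp
  ultimately have "odd u" by (metis even_of_nat)
  then show ?case using u unfolding n_def by (auto simp: mult_ac)
qed


section \<open>Periods of primes\<close>

text \<open>\<open>A\<close> and \<open>B\<close> are the coefficients in
  \<open>(1 + sqrt 5)^n = A + B sqrt 5\<close>, so this is Binet's formula without irrational
  numbers. Summing up to \<open>n\<close> only adds vanishing binomials.\<close>

lemma pow2_fib_binomial:
  fixes n :: nat
  defines "A \<equiv> \<Sum>k\<le>n. (n choose (2 * k)) * 5 ^ k"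
    and "B \<equiv> \<Sum>k\<le>n. (n choose (2 * k + 1)) * 5 ^ k"
  shows "2 * B = 2 ^ n * fib n" and "A + B = 2 ^ n * fib (n + 1)"
proof -
  define a where "a n = (\<Sum>k\<le>n. (n choose (2 * k)) * 5 ^ k)" for n :: nat
  define b where "b n = (\<Sum>k\<le>n. (n choose (2 * k + 1)) * 5 ^ k)" for n :: nat
  \<comment> \<open>Pascal's rule yields the two recurrences that express multiplication by
    \<open>1 + sqrt 5\<close>.\<close>
  have b_Suc: "b (Suc n) = a n + b n" for n
    unfolding a_def b_def by (simp add: sum.distrib algebra_simps binomial_eq_0)
  have a_Suc: "a (Suc n) = a n + 5 * b n" for n
  proof -
    have "a (Suc n) = 1 + (\<Sum>k\<le>n. (Suc n choose (2 * Suc k)) * 5 ^ Suc k)"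
      unfolding a_def by (subst sum.atMost_Suc_shift) simp
    also have "\<dots> = (1 + (\<Sum>k\<le>n. (n choose (2 * Suc k)) * 5 ^ Suc k)) + 5 * b n"
      unfolding b_def by (simp add: sum.distrib algebra_simps sum_distrib_left)
    also have "1 + (\<Sum>k\<le>n. (n choose (2 * Suc k)) * 5 ^ Suc k)
        = (\<Sum>k\<le>Suc n. (n choose (2 * k)) * 5 ^ k)"
      by (subst sum.atMost_Suc_shift) simp
    also have "\<dots> = a n"
      unfolding a_def by (simp add: binomial_eq_0)
    finally show ?thesis .
  qed
  have "2 * b n = 2 ^ n * fib n \<and> a n + b n = 2 ^ n * fib (n + 1)" for n
  proof (induction n)
    case 0
    then show ?case by (simp add: a_def b_def)
  next
    case (Suc n)
    then show ?case by (simp add: a_Suc b_Suc algebra_simps)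
  qed
  then show "2 * B = 2 ^ n * fib n" "A + B = 2 ^ n * fib (n + 1)"
    unfolding A_def B_def a_def b_def by blast+
qed

text \<open>Modulo \<open>q\<close> only the binomials at 0 and \<open>q\<close> survive, so
  \<open>A = 1\<close> and, as \<open>q\<close> is odd, \<open>B = 5^(q div 2)\<close>. Fermat's
  \<open>2^q = 2\<close> then removes the powers of 2.\<close>

lemma fib_prime_cong:
  assumes q: "prime q" "odd q"
  shows "[fib q = 5 ^ (q div 2)] (mod q)" "[2 * fib (q + 1) = 1 + 5 ^ (q div 2)] (mod q)"
proof -
  define A where "A = (\<Sum>k\<le>q. (q choose (2 * k)) * 5 ^ k)"
  define B where "B = (\<Sum>k\<le>q. (q choose (2 * k + 1)) * 5 ^ k)"
  have q2: "2 < q" using q prime_ge_2_nat[OF q(1)] by (cases "q = 2") auto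
  have ch: "[q choose j = (if j = 0 \<or> j = q then 1 else 0)] (mod q)" for j
  proof -
    consider "j = 0 \<or> j = q" | "0 < j" "j < q" | "j > q" by linarith
    then show ?thesis
    proof cases
      case 2
      then have "q dvd (q choose j)" using q by (intro dvd_choose_prime) auto
      then show ?thesis using 2 by (simp add: cong_0_iff)
    qed (auto simp: binomial_eq_0)
  qed
  have "[A = (\<Sum>k\<le>q. (if 2 * k = 0 \<or> 2 * k = q then 1 else 0) * 5 ^ k)] (mod q)"
    unfolding A_def by (intro cong_sum cong_mult ch cong_refl)
  also have "(\<Sum>k\<le>q. (if 2 * k = 0 \<or> 2 * k = q then 1 else 0) * 5 ^ k)
      = (\<Sum>k\<le>q. if k = 0 then 1 else (0::nat))"
    using q(2) by (intro sum.cong) auto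
  also have "\<dots> = 1" by simp
  finally have A: "[A = 1] (mod q)" .
  have "[B = (\<Sum>k\<le>q. (if 2 * k + 1 = 0 \<or> 2 * k + 1 = q then 1 else 0) * 5 ^ k)] (mod q)"
    unfolding B_def by (intro cong_sum cong_mult ch cong_refl)
  also have "(\<Sum>k\<le>q. (if 2 * k + 1 = 0 \<or> 2 * k + 1 = q then 1 else 0) * 5 ^ k)
      = (\<Sum>k\<le>q. if k = q div 2 then 5 ^ k else (0::nat))"
    using q(2) by (intro sum.cong) auto
  also have "\<dots> = 5 ^ (q div 2)" by simp
  finally have B: "[B = 5 ^ (q div 2)] (mod q)" .
  have cop: "coprime 2 q" using q(2) by simp
  have "[2 ^ (q - 1) = 1] (mod q)"
    using q2 by (intro fermat_theorem q) (auto dest: dvd_imp_le)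
  then have "[2 * 2 ^ (q - 1) = 2 * 1] (mod q)" by (intro cong_mult cong_refl)
  then have two: "[2 ^ q = 2] (mod q)"
    using q2 by (simp flip: power_Suc)
  note binom = pow2_fib_binomial[of q, folded A_def B_def]
  have "[2 * fib q = 2 ^ q * fib q] (mod q)"
    using two by (intro cong_mult cong_refl) (rule cong_sym)
  also have "2 ^ q * fib q = 2 * B" using binom by simp
  also have "[2 * B = 2 * 5 ^ (q div 2)] (mod q)"
    using B by (intro cong_mult cong_refl)
  finally show "[fib q = 5 ^ (q div 2)] (mod q)"
    using cop by (simp add: cong_mult_lcancel_nat)
  have "[2 * fib (q + 1) = 2 ^ q * fib (q + 1)] (mod q)"
    using two by (intro cong_mult cong_refl) (rule cong_sym)
  also have "2 ^ q * fib (q + 1) = A + B" using binom by simp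
  also have "[A + B = 1 + 5 ^ (q div 2)] (mod q)"
    using A B by (intro cong_add)
  finally show "[2 * fib (q + 1) = 1 + 5 ^ (q div 2)] (mod q)" .
qed

text \<open>By Fermat, \<open>e = 5^(q div 2)\<close> is 1 or -1 modulo \<open>q\<close>, which
  determines \<open>fib q\<close> and \<open>fib (q + 1)\<close>. The two signs give the two
  alternatives.\<close>

lemma is_period_prime:
  assumes q: "prime q" "odd q" "q \<noteq> 5"
  shows "is_period q (q - 1) \<or> is_period q (2 * (q + 1))"
proof -
  define Q e where "Q = int q" and "e = (5::int) ^ (q div 2)"
  have q2: "2 < q" using q prime_ge_2_nat[OF q(1)] by (cases "q = 2") auto
  have Q: "prime Q" using q by (simp add: Q_def)
  have c2: "coprime Q 2" using q by (simp add: Q_def)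
  have "[5 ^ (q - 1) = 1] (mod q)"
    using q primes_dvd_imp_eq[of q 5] by (intro fermat_theorem q) auto
  then have "[int (5 ^ (q - 1)) = int 1] (mod int q)"
    by (simp only: cong_int_iff)
  moreover have "(5::int) ^ (q - 1) = e * e"
    using q(2) by (auto simp: e_def mult_2 elim!: oddE simp flip: power_add)
  ultimately have "Q dvd (e - 1) * (e + 1)"
    by (simp add: cong_iff_dvd_diff Q_def algebra_simps)
  then have e: "Q dvd e - 1 \<or> Q dvd e + 1" using Q by (simp add: prime_dvd_mult_iff)
  have "[int (fib q) = int (5 ^ (q div 2))] (mod int q)"
    using fib_prime_cong(1)[OF q(1,2)] by (simp only: cong_int_iff)
  then have 1: "Q dvd int (fib q) - e" by (simp add: cong_iff_dvd_diff Q_def e_def)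
  have "[int (2 * fib (q + 1)) = int (1 + 5 ^ (q div 2))] (mod int q)"
    using fib_prime_cong(2)[OF q(1,2)] by (simp only: cong_int_iff)
  then have 2: "Q dvd 2 * int (fib (q + 1)) - (1 + e)"
    by (simp add: cong_iff_dvd_diff Q_def e_def)
  from e show ?thesis
  proof
    assume h: "Q dvd e - 1"
    have f1: "Q dvd int (fib q) - 1" using dvd_add[OF 1 h] by simp
    have "Q dvd 2 * (int (fib (q + 1)) - 1)" using dvd_add[OF 2 h] by (simp add: algebra_simps)
    then have f2: "Q dvd int (fib (q + 1)) - 1"
      using c2 coprime_dvd_mult_right_iff by blast
    obtain r where r: "q = Suc r" using q2 by (cases q) auto
    have "Q dvd int (fib (q - 1))"
      using dvd_diff[OF f2 f1] by (simp add: r)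
    then show ?thesis
      using f1 by (simp add: is_period_iff_int Q_def r)
  next
    \<comment> \<open>Now \<open>P^(q + 1) = -I\<close> modulo \<open>q\<close>, and squaring gives
      \<open>I\<close>.\<close>
    assume h: "Q dvd e + 1"
    have f1: "Q dvd int (fib q) + 1" using dvd_add[OF 1 h] by simp
    have "Q dvd 2 * int (fib (q + 1))" using dvd_add[OF 2 h] by simp
    then have f2: "Q dvd int (fib (q + 1))"
      using c2 coprime_dvd_mult_right_iff by blast
    have f3: "Q dvd int (fib (q + 1 + 1)) + 1"
      using dvd_add[OF f1 f2] by (simp add: algebra_simps)
    have "fib (q + 1) dvd fib (2 * (q + 1))" by (rule fib_dvd_fib[OF dvd_triv_right])
    then have g1: "Q dvd int (fib (2 * (q + 1)))"
      using f2 unfolding Q_def by (simp only: int_dvd_int_iff) (rule dvd_trans)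
    have "fib (2 * (q + 1) + 1) = fib (q + 1 + 1) * fib (q + 1 + 1) + fib (q + 1) * fib (q + 1)"
      using fib_add[of "q + 1" "q + 1"] by (simp only: mult_2 Suc_eq_plus1)
    then have "int (fib (2 * (q + 1) + 1)) - 1
        = (int (fib (q + 1 + 1)) + 1) * (int (fib (q + 1 + 1)) - 1) + int (fib (q + 1)) * int (fib (q + 1))"
      by (simp add: algebra_simps del: fib.simps)
    also have "Q dvd \<dots>"
      by (intro dvd_add dvd_mult2[OF f3] dvd_mult2[OF f2])
    finally show ?thesis
      using g1 unfolding is_period_iff_int Q_def by blast
  qed
qed

text \<open>2 and 5 are the primes that \<open>is_period_prime\<close> leaves out; the indices for 2
  and 3 also serve the moduli \<open>3^e * 2^f\<close>.\<close>

lemma is_period_2_3: "is_period 2 3"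
  and is_period_3_8: "is_period 3 8"
  and is_period_5_20: "is_period 5 20"
proof -
  have "fib 3 = 2" "fib (3 + 1) = 3" "fib 8 = 21" "fib (8 + 1) = 34"
    "fib 20 = 6765" "fib (20 + 1) = 10946"
    by code_simp+
  then show "is_period 2 3" "is_period 3 8" "is_period 5 20"
    unfolding is_period_def by (simp_all only:) (simp_all add: cong_def)
qed

text \<open>A prime \<open>p > q\<close> cannot divide \<open>q - 1\<close>, and it divides
  \<open>2 (q + 1)\<close> only if \<open>p = q + 1\<close>, which is even for odd \<open>q\<close>.
  The bound 5 excludes \<open>p = 3\<close>, which divides the period 3 of 2.\<close>

lemma prime_period_not_dvd:
  assumes "prime p" "prime q" "q < p" "p \<ge> 5"
  shows "\<exists>n. is_period q n \<and> \<not> p dvd n"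
proof -
  have p2: "\<not> p dvd 2" using assms by (auto dest: dvd_imp_le)
  consider "q = 2" | "q = 5" | "odd q" "q \<noteq> 5"
    using assms(2) prime_odd_nat prime_ge_2_nat by (metis le_neq_implies_less)
  then show ?thesis
  proof cases
    case 1
    have "\<not> p dvd 3" using assms(4) by (auto dest: dvd_imp_le)
    then show ?thesis using 1 is_period_2_3 by blast
  next
    case 2
    have "\<not> p dvd 20"
    proof
      assume "p dvd 20"
      then have "p dvd 2 * (2 * 5)" by simp
      then have "p dvd 5" using p2 assms(1) by (metis prime_dvd_mult_iff)
      then show False using assms(3) 2 by (auto dest: dvd_imp_le)
    qed
    then show ?thesis using 2 is_period_5_20 by blast
  next
    case 3
    have q1: "1 < q" using assms(2) by (rule prime_gt_1_nat)
    have "\<not> p dvd q - 1" using q1 assms(3) by (auto dest!: dvd_imp_le)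
    moreover have "\<not> p dvd 2 * (q + 1)"
    proof
      assume "p dvd 2 * (q + 1)"
      then have "p dvd q + 1" using p2 assms(1) by (simp only: prime_dvd_mult_iff) simp
      then have "p \<le> q + 1" by (rule dvd_imp_le) simp
      then have "p = q + 1" using assms(3) by simp
      then have "even p" using 3 by simp
      then show False using assms(1,4) prime_odd_nat[of p] by auto
    qed
    ultimately show ?thesis using is_period_prime[OF assms(2) 3] by blast
  qed
qed

text \<open>Build \<open>m\<close> up prime by prime: a repeated prime \<open>q\<close> multiplies
  the index by \<open>q < p\<close>, and a new one multiplies it by an index for \<open>q\<close>
  that is prime to \<open>p\<close>.\<close>

lemma small_primes_period_not_dvd:
  assumes "prime p" "p \<ge> 5" "m \<ge> 1" "\<And>q. prime q \<Longrightarrow> q dvd m \<Longrightarrow> q < p"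
  shows "\<exists>n. is_period m n \<and> \<not> p dvd n"
  using assms(3,4)
proof (induction m rule: prime_divisors_induct)
  case zero
  then show ?case by simp
next
  case (unit m)
  have "is_period m 1" using unit by (simp add: is_period_def)
  then show ?case using assms(1) not_prime_unit by blast
next
  case (factor q m)
  have qp: "q < p" using factor by simp
  obtain n where n: "is_period m n" "\<not> p dvd n"
    using factor by fastforce
  show ?case
  proof (cases "q dvd m")
    case True
    have "\<not> p dvd q" using qp factor.hyps prime_gt_0_nat by (auto dest: dvd_imp_le)
    then have "\<not> p dvd n * q" using n assms(1) by (simp add: prime_dvd_mult_iff)
    then show ?thesis using is_period_lift[OF True n(1)] by blast
  next
    case False
    obtain k where k: "is_period q k" "\<not> p dvd k"
      using prime_period_not_dvd[OF assms(1) factor.hyps qp assms(2)] by blast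
    have "coprime q m" using False factor.hyps by (simp add: prime_imp_coprime)
    then have "is_period (q * m) (k * n)"
      using k n by (intro is_period_coprime_mult')
    moreover have "\<not> p dvd k * n" using k n assms(1) by (simp add: prime_dvd_mult_iff)
    ultimately show ?thesis by blast
  qed
qed

section \<open>Excluding prime factors from 5 on\<close>

lemma is_period_prime_power:
  assumes "is_period p n"
  shows "is_period (p ^ Suc e) (n * p ^ e)"
proof (induction e)
  case (Suc e)
  show ?case
    using is_period_lift[of p "p ^ Suc e" "n * p ^ e", OF _ Suc] by (simp add: mult_ac)
qed (use assms in simp)

text \<open>At such an index the exponent of \<open>p\<close> is exactly \<open>e + 1\<close>, while
  \<open>m^2\<close> demands at least \<open>2 (e + 1)\<close>. This serves both the largest prime
  \<open>p >= 5\<close> and \<open>p = 3\<close>.\<close>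

lemma square_dvd_imp_no_period:
  assumes p: "prime p" "odd p" "is_period p n" "\<not> p\<^sup>2 dvd fib n"
    and r: "\<not> p dvd r" and m: "m \<ge> 1" "p ^ Suc e dvd m" "m\<^sup>2 dvd fib (fib_period m)"
  shows "\<not> is_period m (n * p ^ e * r)"
proof
  assume "is_period m (n * p ^ e * r)"
  then have "m\<^sup>2 dvd fib (n * p ^ e * r)"
    using fib_fib_period_dvd m dvd_trans by blast
  moreover have "(p ^ Suc e)\<^sup>2 dvd m\<^sup>2" using m(2) by simp
  moreover have "p ^ (e + 2) dvd (p ^ Suc e)\<^sup>2"
    by (simp add: power2_eq_square mult_ac)
  ultimately have "p ^ (e + 2) dvd fib (n * p ^ e * r)" by (meson dvd_trans)
  moreover have "p dvd fib n" using p(3) by (simp add: is_period_def cong_0_iff)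
  ultimately show False using fib_val[OF p(1,2) _ p(4) r] by blast
qed

lemma square_dvd_imp_prime_factor_less_5:
  assumes A: "\<And>p::nat. prime p \<Longrightarrow> \<not> p\<^sup>2 dvd fib (fib_period p)"
    and m: "m \<ge> 1" "m\<^sup>2 dvd fib (fib_period m)" and q: "prime q" "q dvd m"
  shows "q < 5"
proof -
  \<comment> \<open>For the largest prime factor, the cofactor \<open>m'\<close> has only smaller
    ones, as \<open>small_primes_period_not_dvd\<close> requires.\<close>
  define p where "p = Max (prime_factors m)"
  have "finite (prime_factors m)" "prime_factors m \<noteq> {}"
    using m q by (auto simp: prime_factors_dvd)
  then have pm: "p \<in> prime_factors m" and mx: "\<And>q. q \<in> prime_factors m \<Longrightarrow> q \<le> p"
    unfolding p_def by auto
  have pp: "prime p" using pm by auto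
  have "\<not> p \<ge> 5"
  proof
    assume p5: "p \<ge> 5"
    have "m \<noteq> 0" "\<not> is_unit p" using m pp by auto
    then obtain m' where m': "m = p ^ multiplicity p m * m'" "\<not> p dvd m'"
      by (rule multiplicity_decompose')
    have "multiplicity p m \<noteq> 0" using pm by (auto simp: prime_factors_multiplicity)
    then obtain e where e: "multiplicity p m = Suc e" using not0_implies_Suc by blast
    note m' = m'[unfolded e]
    have "m' \<ge> 1" using m m' by (cases m') auto
    moreover have "q < p" if "prime q" "q dvd m'" for q
    proof -
      have "q \<in> prime_factors m" using that m m' by (auto simp: prime_factors_dvd)
      then show ?thesis using mx[of q] that m' by (cases "q = p") auto
    qed
    ultimately obtain r where r: "is_period m' r" "\<not> p dvd r"
      using small_primes_period_not_dvd[OF pp p5] by blast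
    have per: "is_period p (fib_period p)"
      using is_period_fib_period p5 by simp
    have "coprime (p ^ Suc e) m'" using pp m'(2) by (simp add: prime_imp_coprime)
    then have "is_period m (fib_period p * p ^ e * r)"
      using is_period_coprime_mult' is_period_prime_power[OF per] r m'(1) by metis
    moreover have "odd p" using pp p5 prime_odd_nat[of p] by simp
    moreover have "p ^ Suc e dvd m" using m'(1) by simp
    ultimately show False
      using square_dvd_imp_no_period[OF pp _ per A[OF pp] r(2) m(1) _ m(2)] by blast
  qed
  moreover have "q \<le> p" using mx q m by (simp add: prime_factors_dvd)
  ultimately show ?thesis by simp
qed


section \<open>Moduli composed of 2 and 3\<close>

lemma three_smooth_decompose:
  fixes m :: nat
  assumes "m \<ge> 1" "\<And>q. prime q \<Longrightarrow> q dvd m \<Longrightarrow> q < 5"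
  obtains e f where "m = 3 ^ e * 2 ^ f"
proof -
  have "m \<noteq> 0" "\<not> is_unit (3::nat)" using assms(1) by auto
  then obtain m' where m': "m = 3 ^ multiplicity 3 m * m'" "\<not> 3 dvd m'"
    by (rule multiplicity_decompose')
  have "m' \<noteq> 0" "\<not> is_unit (2::nat)" using m'(2) by (auto intro: ccontr)
  then obtain r where r: "m' = 2 ^ multiplicity 2 m' * r" "\<not> 2 dvd r"
    by (rule multiplicity_decompose')
  have "r = 1"
  proof (rule ccontr)
    assume "r \<noteq> 1"
    then obtain q where q: "prime q" "q dvd r" using prime_factor_nat by blast
    have "r dvd m'" "m' dvd m" using m'(1) r(1) by (metis dvd_triv_right)+
    then have "q dvd m'" "q dvd m" using q(2) by (auto intro: dvd_trans)
    then have "q < 5" "q \<noteq> 3" "q \<noteq> 2" using assms(2) q m'(2) r(2) by auto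
    moreover have "q \<ge> 2" using q(1) by (rule prime_ge_2_nat)
    ultimately have "q = 4" by simp
    moreover have "\<not> prime (4::nat)" by simp
    ultimately show False using q(1) by blast
  qed
  then show ?thesis using that m'(1) r(1) by (metis mult.right_neutral)
qed

lemma not_power_2_dvd_fib: "j + 3 < k \<Longrightarrow> \<not> 2 ^ k dvd fib (6 * 2 ^ j)"
proof
  assume "j + 3 < k" "2 ^ k dvd fib (6 * 2 ^ j)"
  then have "2 ^ Suc (j + 3) dvd fib (6 * 2 ^ j)"
    by (meson Suc_leI power_le_dvd)
  then have "2 ^ (j + 3) * 2 dvd fib (6 * 2 ^ j)"
    by (simp only: power_Suc2)
  then show False
    using fib_6_times_power_2[of j] by auto
qed

lemma three_smooth_square_dvd:
  assumes m: "m \<ge> 2" "m\<^sup>2 dvd fib (fib_period m)" "m = 3 ^ e * 2 ^ f"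
  shows "m \<in> {6, 12}"
proof -
  have dvd: "m\<^sup>2 dvd fib n" if "is_period m n" for n
    using that m fib_fib_period_dvd[of m n] dvd_trans by auto
  have "(2 ^ f)\<^sup>2 dvd m\<^sup>2" unfolding m(3) by (simp add: power_mult_distrib)
  then have two: "2 ^ (2 * f) dvd fib n" if "is_period m n" for n
    using dvd[OF that] by (metis dvd_trans mult.commute power_mult)
  have fib3: "fib 3 = 2" and fib8: "fib 8 = 21"
    by code_simp+
  have cop: "coprime (3 ^ e) (2 ^ f :: nat)"
    by simp
  \<comment> \<open>For \<open>f = 0\<close> the truncated exponent gives the index 3, which is
    admissible because the modulus is 1; likewise for \<open>e = 0\<close> in
    \<open>per3\<close>.\<close>
  have per2: "is_period (2 ^ f) (3 * 2 ^ (f - 1))"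
    using is_period_prime_power[OF is_period_2_3, of "f - 1"]
    by (cases f) (simp_all add: is_period_def)
  have per3: "is_period (3 ^ e) (8 * 3 ^ (e - 1))"
    using is_period_prime_power[OF is_period_3_8, of "e - 1"]
    by (cases e) (simp_all add: is_period_def)
  \<comment> \<open>The fourth and fifth cases are \<open>m = 6\<close> and \<open>m = 12\<close>,
    the only ones that survive.\<close>
  consider "e = 0" "f \<le> 1" | "e = 0" "f \<ge> 2" | "e = 1" "f = 0" | "e = 1" "f = 1" | "e = 1" "f = 2"
    | "e = 1" "f \<ge> 3" | "e \<ge> 2"
    by linarith
  then show ?thesis
  proof cases
    case 1
    then have "m = 2" using m by (cases f) auto
    then show ?thesis using dvd[of 3] fib3 is_period_2_3 by (auto dest: dvd_imp_le)
  next
    case 2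
    then obtain g where g: "f = g + 2" using le_Suc_ex[of 2 f] by auto
    \<comment> \<open>The exponent of 2 at this index is \<open>g + 3\<close>, short of the required
      \<open>2 f = 2 g + 4\<close>.\<close>
    have "is_period m (6 * 2 ^ g)" using per2 2 m(3) g by simp
    then have "2 ^ (2 * f) dvd fib (6 * 2 ^ g)" by (rule two)
    then show ?thesis using not_power_2_dvd_fib[of g "2 * f"] g by simp
  next
    case 3
    then have "m = 3" using m by simp
    then show ?thesis using dvd[of 8] fib8 is_period_3_8 by auto
  next
    case 6
    \<comment> \<open>This is the least \<open>g\<close> for which \<open>6 * 2^g\<close> is a
      multiple of both \<open>3 * 2^(f - 1)\<close> and 8. The bound \<open>g + 3 < 2 f\<close>
      starts to hold at \<open>f = 3\<close>.\<close>
    define g where "g = max (f - 2) 2"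
    have g: "f - 1 \<le> Suc g" "3 \<le> Suc g" "g + 3 < 2 * f" using 6 by (auto simp: g_def)
    have "is_period (2 ^ f) (3 * 2 ^ Suc g)"
      using g by (intro is_period_dvd[OF per2] mult_dvd_mono le_imp_power_dvd) auto
    moreover have "8 * 3 ^ (e - 1) dvd (3 * 2 ^ Suc g :: nat)"
      using le_imp_power_dvd[OF g(2), of "2::nat"] 6 by simp
    then have "is_period (3 ^ e) (3 * 2 ^ Suc g)"
      by (rule is_period_dvd[OF per3])
    ultimately have "is_period m (3 * 2 ^ Suc g)"
      using is_period_coprime_mult[OF cop] m(3) by simp
    then have "2 ^ (2 * f) dvd fib (6 * 2 ^ g)" using two[of "3 * 2 ^ Suc g"] by simp
    then show ?thesis using not_power_2_dvd_fib[OF g(3)] by blast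
  next
    case 7
    then obtain h where h: "e = Suc (Suc h)" using le_Suc_ex[of 2 e] by auto
    \<comment> \<open>For \<open>e >= 2\<close> the power \<open>3^(e - 1)\<close> already contains
      the factor 3 required by \<open>per2\<close>. For \<open>e = 1\<close> an extra 3 would be
      needed, raising the exponent of 3 in the Fibonacci number.\<close>
    let ?n = "8 * 3 ^ (e - 1) * 2 ^ f :: nat"
    have "?n = 3 * 2 ^ (f - 1) * (8 * 3 ^ h * (if f = 0 then 1 else 2))"
      using h by (cases f) simp_all
    then have "is_period (2 ^ f) ?n" by (metis is_period_mult[OF per2])
    then have "is_period m ?n"
      using is_period_coprime_mult[OF cop is_period_mult[OF per3]] m(3) by simp
    moreover have "\<not> 3 dvd (2 ^ f :: nat)"
      using prime_dvd_power[of "3::nat" 2 f] by auto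
    moreover have "3 ^ Suc (e - 1) dvd m" using h m(3) by simp
    moreover have "\<not> 3\<^sup>2 dvd fib 8" by (simp add: fib8)
    ultimately show ?thesis
      using square_dvd_imp_no_period[of 3 8 "2 ^ f" m "e - 1"] is_period_3_8 m by simp
  qed (use m in auto)
qed

theorem theorem2p4:
  shows "(\<forall>p::nat. prime p \<longrightarrow> \<not> p\<^sup>2 dvd fib (fib_period p)) \<longleftrightarrow>
         (\<forall>m::nat. m \<ge> 2 \<longrightarrow> m\<^sup>2 dvd fib (fib_period m) \<longrightarrow> m \<in> {6, 12})"
proof
  assume A: "\<forall>p::nat. prime p \<longrightarrow> \<not> p\<^sup>2 dvd fib (fib_period p)"
  show "\<forall>m::nat. m \<ge> 2 \<longrightarrow> m\<^sup>2 dvd fib (fib_period m) \<longrightarrow> m \<in> {6, 12}"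
  proof (intro allI impI)
    fix m :: nat
    assume m: "m \<ge> 2" "m\<^sup>2 dvd fib (fib_period m)"
    then have "q < 5" if "prime q" "q dvd m" for q
      using square_dvd_imp_prime_factor_less_5[of m q] A that by simp
    moreover have "m \<ge> 1" using m(1) by simp
    ultimately obtain e f where "m = 3 ^ e * 2 ^ f"
      using three_smooth_decompose by blast
    then show "m \<in> {6, 12}" using three_smooth_square_dvd m by blast
  qed
next
  assume B: "\<forall>m::nat. m \<ge> 2 \<longrightarrow> m\<^sup>2 dvd fib (fib_period m) \<longrightarrow> m \<in> {6, 12}"
  have "\<not> prime (6::nat)" "\<not> prime (12::nat)" by simp_all
  then show "\<forall>p::nat. prime p \<longrightarrow> \<not> p\<^sup>2 dvd fib (fib_period p)"
    using B prime_ge_2_nat by (metis insertE singletonD)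
qed

end
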